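(* Let $T$ be a densely defined closable operator in a complex Hilbert space $H$. If $TT^*$ is densely defined, then $$\sigma(TT^* )\neq\mathbb{C}\iff (TT^* )^*=\overline{T}T^*=TT^*.$$ Similarly, if $T^*T$ is densely defined, then $$\sigma(T^*T)\neq\mathbb{C}\iff (T^*T)^*=T^*\overline{T}=T^*T.$$
   Context: All operators are linear and possibly unbounded; $\overline{T}$ is the closure of $T$. Products carry their natural domains: $D(AB)=\{x\in D(B):Bx\in D(A)\}$. Equality of operators includes equality of domains. The resolvent set of an operator $A$ (not assumed closed) is $\rho(A)=\{\lambda\in\mathbb{C}:\lambda I-A \text{ is bijective from } D(A) \text{ onto } H \text{ and } (\lambda I-A)^{-1}\in B(H)\}$, where $B(H)$ is the set of bounded everywhere defined operators, and $\sigma(A)=\mathbb{C}\setminus\rho(A)$; thus $\sigma(A)=\mathbb{C}$ when $A$ is not closed. *)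

theory Defs
  imports "HOL-Analysis.Analysis"
begin

section \<open>Complex Hilbert spaces\<close>

text \<open>
  The complex structure is put on top of the library's real normed spaces, so that topology,
  completeness and \<^const>\<open>bounded_linear\<close> are those of HOL-Analysis. The first axiom makes the
  given real scalar multiplication the restriction of the complex one.
\<close>

class complex_vector = real_vector +
  fixes scaleC :: "complex \<Rightarrow> 'a \<Rightarrow> 'a"  (infixr \<open>*\<^sub>C\<close> 75)
  assumes scaleR_scaleC: "scaleR r x = complex_of_real r *\<^sub>C x"
    and scaleC_add_right: "a *\<^sub>C (x + y) = a *\<^sub>C x + a *\<^sub>C y"
    and scaleC_add_left: "(a + b) *\<^sub>C x = a *\<^sub>C x + b *\<^sub>C x"
    and scaleC_scaleC: "a *\<^sub>C b *\<^sub>C x = (a * b) *\<^sub>C x"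
    and scaleC_one: "1 *\<^sub>C x = x"

text \<open>The inner product is linear in the first and conjugate-linear in the second argument.\<close>

class complex_inner = complex_vector + real_normed_vector +
  fixes cinner :: "'a \<Rightarrow> 'a \<Rightarrow> complex"
  assumes cinner_commute: "cinner x y = cnj (cinner y x)"
    and cinner_add_left: "cinner (x + y) z = cinner x z + cinner y z"
    and cinner_scaleC_left: "cinner (a *\<^sub>C x) y = a * cinner x y"
    and cinner_self_norm: "cinner x x = complex_of_real ((norm x)\<^sup>2)"

class complex_hilbert_space = complex_inner + complete_space

instantiation complex :: complex_hilbert_space
begin

definition scaleC_complex :: "complex \<Rightarrow> complex \<Rightarrow> complex"
  where "scaleC_complex a x = a * x"

definition cinner_complex :: "complex \<Rightarrow> complex \<Rightarrow> complex"
  where "cinner_complex x y = x * cnj y"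

instance
  by standard
    (simp_all add: scaleC_complex_def cinner_complex_def scaleR_conv_of_real algebra_simps
      flip: complex_norm_square)

end


section \<open>Unbounded operators\<close>

text \<open>
  An operator is a partial function, so \<^const>\<open>dom\<close> is its domain, equality of operators includes
  equality of domains, and the product \<open>A B\<close> on its natural domain is the composition
  \<open>A \<circ>\<^sub>m B\<close> of partial functions.
\<close>

type_synonym 'a operator = "'a \<rightharpoonup> 'a"

lemma dom_map_comp_natural: "dom (A \<circ>\<^sub>m B) = {x \<in> dom B. the (B x) \<in> dom A}"
  by (auto simp: map_comp_def split: option.splits)

definition linear_op :: "'a::complex_vector operator \<Rightarrow> bool" where
  "linear_op T \<longleftrightarrow>
     0 \<in> dom T \<and>
     (\<forall>x\<in>dom T. \<forall>y\<in>dom T. T (x + y) = Some (the (T x) + the (T y))) \<and>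
     (\<forall>c. \<forall>x\<in>dom T. T (c *\<^sub>C x) = Some (c *\<^sub>C the (T x)))"

definition densely_defined :: "'a::topological_space operator \<Rightarrow> bool" where
  "densely_defined T \<longleftrightarrow> closure (dom T) = UNIV"

definition closable_op :: "'a::topological_space operator \<Rightarrow> bool" where
  "closable_op T \<longleftrightarrow> single_valued (closure (Map.graph T))"

text \<open>The operator whose graph is the closure of the graph of \<open>T\<close>; meaningful if \<open>T\<close> is closable.\<close>

definition closure_op :: "'a::topological_space operator \<Rightarrow> 'a operator" where
  "closure_op T = (\<lambda>x. if \<exists>y. (x, y) \<in> closure (Map.graph T)
                        then Some (THE y. (x, y) \<in> closure (Map.graph T)) else None)"

lemma graph_closure_op:
  assumes "closable_op T"
  shows "Map.graph (closure_op T) = closure (Map.graph T)"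
proof -
  have "(THE y. (x, y) \<in> closure (Map.graph T)) = z" if "(x, z) \<in> closure (Map.graph T)" for x z
    using that assms by (auto simp: closable_op_def single_valued_def)
  then show ?thesis
    by (fastforce simp: closure_op_def Map.graph_def split: if_splits)
qed

text \<open>
  \<open>y\<close> is in the domain of the adjoint if some \<open>z\<close> satisfies \<open>\<langle>T x, y\<rangle> = \<langle>x, z\<rangle>\<close> for all \<open>x\<close> in the
  domain of \<open>T\<close>, and then \<open>z\<close> is the value. It is unique if \<open>T\<close> is densely defined, and the
  definition is meaningful only in that case.
\<close>

definition adjoint_op :: "'a::complex_inner operator \<Rightarrow> 'a operator" where
  "adjoint_op T = (\<lambda>y. if \<exists>z. \<forall>x\<in>dom T. cinner (the (T x)) y = cinner x z
                        then Some (THE z. \<forall>x\<in>dom T. cinner (the (T x)) y = cinner x z) else None)"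

text \<open>Membership in \<open>B(H)\<close>; totality is expressed by the function type.\<close>

definition bounded_clinear :: "('a::complex_inner \<Rightarrow> 'a) \<Rightarrow> bool" where
  "bounded_clinear f \<longleftrightarrow> bounded_linear f \<and> (\<forall>c x. f (c *\<^sub>C x) = c *\<^sub>C f x)"

definition resolvent_set :: "'a::complex_inner operator \<Rightarrow> complex set" where
  "resolvent_set A =
     {l. bij_betw (\<lambda>x. l *\<^sub>C x - the (A x)) (dom A) UNIV \<and>
         bounded_clinear (inv_into (dom A) (\<lambda>x. l *\<^sub>C x - the (A x)))}"

definition spectrum_op :: "'a::complex_inner operator \<Rightarrow> complex set" where
  "spectrum_op A = - resolvent_set A"

end

theory Submission
  imports Defs
begin

text \<open>
  Let \<open>S\<close> be the closure of \<open>T\<close>. The orthogonal decomposition of \<open>H \<times> H\<close> into the graph of \<open>S\<close> and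
  its complement \<open>{(- T\<^sup>* b, b)}\<close>, applied to \<open>(0, h)\<close> and \<open>(h, 0)\<close>, shows that \<open>I + B\<close> is onto for
  \<open>B = S T\<^sup>*\<close> and for \<open>B = T\<^sup>* S\<close>; both are positive and symmetric. A densely defined such \<open>B\<close> is
  self-adjoint with \<open>- 1\<close> in its resolvent set. If a restriction \<open>A\<close> of \<open>B\<close> has some
  \<open>\<lambda> I - A\<close> bijective, then \<open>\<lambda> I - B\<close> is injective (for real \<open>\<lambda>\<close> because its kernel is orthogonal
  to the range of \<open>\<lambda> I - A\<close>, otherwise because symmetric operators have no nonreal eigenvalues),
  so \<open>A = B\<close>.
\<close>

section \<open>Complex inner product spaces\<close>

lemma scaleC_zero_left [simp]: "0 *\<^sub>C x = 0"
  using scaleC_add_left[of 0 0 x] by simp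

lemma scaleC_zero_right [simp]: "a *\<^sub>C 0 = 0"
  using scaleC_add_right[of a 0 0] by simp

lemma scaleC_minus_left: "(- a) *\<^sub>C x = - (a *\<^sub>C x)"
  using scaleC_add_left[of a "- a" x] by (simp add: eq_neg_iff_add_eq_0 add.commute)

lemma scaleC_minus_right: "a *\<^sub>C (- x) = - (a *\<^sub>C x)"
  using scaleC_add_right[of a x "- x"] by (simp add: eq_neg_iff_add_eq_0 add.commute)

lemma scaleC_diff_right: "a *\<^sub>C (x - y) = a *\<^sub>C x - a *\<^sub>C y"
  using scaleC_add_right[of a x "- y"] by (simp add: scaleC_minus_right)

lemma scaleC_minus1_left: "(- 1) *\<^sub>C x = - x"
  by (simp add: scaleC_minus_left scaleC_one)

lemma cinner_add_right: "cinner x (y + z) = cinner x y + cinner x z"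
  by (simp add: cinner_commute[of x] cinner_add_left)

lemma cinner_scaleC_right: "cinner x (a *\<^sub>C y) = cnj a * cinner x y"
  by (simp add: cinner_commute[of x] cinner_scaleC_left)

lemma cinner_zero_left [simp]: "cinner 0 y = 0"
  using cinner_add_left[of 0 0 y] by simp

lemma cinner_zero_right [simp]: "cinner x 0 = 0"
  using cinner_add_right[of x 0 0] by simp

lemma cinner_minus_left: "cinner (- x) y = - cinner x y"
  using cinner_add_left[of x "- x" y] by (simp add: add_eq_0_iff)

lemma cinner_minus_right: "cinner x (- y) = - cinner x y"
  using cinner_add_right[of x y "- y"] by (simp add: add_eq_0_iff)

lemma cinner_diff_left: "cinner (x - y) z = cinner x z - cinner y z"
  using cinner_add_left[of x "- y" z] by (simp add: cinner_minus_left)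

lemma cinner_diff_right: "cinner x (y - z) = cinner x y - cinner x z"
  using cinner_add_right[of x y "- z"] by (simp add: cinner_minus_right)

lemma cinner_self_eq_0_iff [simp]: "cinner x x = 0 \<longleftrightarrow> x = 0"
  by (simp add: cinner_self_norm)

section \<open>Norm identities and continuity of the inner product\<close>

lemma norm_scaleC: "norm (a *\<^sub>C x) = cmod a * norm (x::'a::complex_inner)"
proof -
  have "complex_of_real ((norm (a *\<^sub>C x))\<^sup>2) = complex_of_real ((cmod a * norm x)\<^sup>2)"
    unfolding power_mult_distrib of_real_mult complex_norm_square
    unfolding cinner_self_norm[symmetric] cinner_scaleC_left cinner_scaleC_right
    by (simp only: mult_ac)
  then show ?thesis
    unfolding of_real_eq_iff by simp
qed

lemma norm_add_square: "(norm (x + y))\<^sup>2 = (norm x)\<^sup>2 + (norm y)\<^sup>2 + 2 * Re (cinner x y)"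
proof -
  have "Re (cinner y x) = Re (cinner x y)"
    by (simp add: cinner_commute[of y x])
  moreover have "Re (cinner (x + y) (x + y)) = (norm (x + y))\<^sup>2"
    "Re (cinner x x) = (norm x)\<^sup>2" "Re (cinner y y) = (norm y)\<^sup>2"
    by (simp_all add: cinner_self_norm)
  ultimately show ?thesis
    by (simp add: cinner_add_left cinner_add_right)
qed

lemma norm_diff_square: "(norm (x - y))\<^sup>2 = (norm x)\<^sup>2 + (norm y)\<^sup>2 - 2 * Re (cinner x y)"
  using norm_add_square[of x "- y"] by (simp add: cinner_minus_right)

text \<open>Polarization gives continuity without the Cauchy-Schwarz inequality.\<close>

lemma continuous_on_cinner_left:
  fixes y :: "'a::complex_inner"
  assumes "continuous_on A f"
  shows "continuous_on A (\<lambda>x. cinner (f x) y)"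
proof -
  have Re_eq: "Re (cinner x y) = ((norm (x + y))\<^sup>2 - (norm x)\<^sup>2 - (norm y)\<^sup>2) / 2" for x y :: 'a
    by (simp add: norm_add_square)
  \<comment> \<open>The imaginary part of the inner product is its real part with \<open>y\<close>
    replaced by \<open>\<i> *\<^sub>C y\<close>, so polarization of the real part alone
    suffices.\<close>
  have "cinner x y = Complex (Re (cinner x y)) (Re (cinner x (\<i> *\<^sub>C y)))" for x
    by (simp add: cinner_scaleC_right complex_eq_iff)
  then have "(\<lambda>x. cinner (f x) y) =
      (\<lambda>x. Complex (Re (cinner (f x) y)) (Re (cinner (f x) (\<i> *\<^sub>C y))))"
    by blast
  then show ?thesis
    by (simp only: Re_eq Complex_eq) (intro continuous_intros assms; simp)
qed

lemma bounded_linear_scaleC: "bounded_linear (\<lambda>x::'a::complex_inner. c *\<^sub>C x)"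
proof (rule bounded_linear_intro[where K = "cmod c"])
  fix x y :: 'a and r
  show "c *\<^sub>C (x + y) = c *\<^sub>C x + c *\<^sub>C y"
    by (rule scaleC_add_right)
  show "c *\<^sub>C r *\<^sub>R x = r *\<^sub>R c *\<^sub>C x"
    by (simp add: scaleR_scaleC scaleC_scaleC mult.commute)
  show "norm (c *\<^sub>C x) \<le> norm x * cmod c"
    by (simp add: norm_scaleC mult.commute)
qed

text \<open>The vectors orthogonal to \<open>z\<close> form a closed set, so density puts
  \<open>z\<close> itself into it. This is what makes values of the adjoint unique.\<close>

lemma orthogonal_dense_imp_zero:
  fixes z :: "'a::complex_inner"
  assumes "closure A = UNIV" and "\<And>x. x \<in> A \<Longrightarrow> cinner x z = 0"
  shows "z = 0"
proof -
  have "closed {x. cinner x z = 0}"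
    by (intro closed_Collect_eq continuous_on_cinner_left continuous_intros)
  then have "closure A \<subseteq> {x. cinner x z = 0}"
    using assms(2) by (intro closure_minimal subsetI CollectI)
  then have "z \<in> {x. cinner x z = 0}"
    unfolding assms(1) by (rule subsetD) (rule UNIV_I)
  then show ?thesis
    by simp
qed

text \<open>The point \<open>m\<close> is the one of \<open>G\<close> nearest to \<open>p\<close>: a
  minimizing sequence is Cauchy by the parallelogram law, and a nonzero component of
  \<open>p - m\<close> along some \<open>u\<close> in \<open>G\<close> would allow a still smaller
  distance.\<close>

lemma orthogonal_projection_exists:
  fixes G :: "'a::complex_hilbert_space set"
  assumes "closed G" and "0 \<in> G"
    and add: "\<And>x y. x \<in> G \<Longrightarrow> y \<in> G \<Longrightarrow> x + y \<in> G"
    and scale: "\<And>c x. x \<in> G \<Longrightarrow> c *\<^sub>C x \<in> G"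
  obtains m where "m \<in> G" and "\<And>u. u \<in> G \<Longrightarrow> cinner u (p - m) = 0"
proof -
  define d where "d = (INF m\<in>G. (norm (p - m))\<^sup>2)"
  have bdd: "bdd_below ((\<lambda>m. (norm (p - m))\<^sup>2) ` G)"
    by (intro bdd_belowI[of _ 0]) auto
  have d_le: "d \<le> (norm (p - m))\<^sup>2" if "m \<in> G" for m
    unfolding d_def using bdd that by (rule cINF_lower)
  have "\<exists>m\<in>G. (norm (p - m))\<^sup>2 < d + e" if "e > 0" for e
  proof (rule ccontr)
    assume "\<not> ?thesis"
    then have "d + e \<le> d"
      unfolding d_def using assms(2) by (intro cINF_greatest) (auto simp: not_less d_def)
    then show False
      using that by simp
  qed
  then have "\<exists>m\<in>G. (norm (p - m))\<^sup>2 < d + 1 / real (Suc k)" for k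
    by simp
  then obtain m where m: "\<And>k. m k \<in> G" "\<And>k. (norm (p - m k))\<^sup>2 < d + 1 / real (Suc k)"
    by metis
  have parallelogram: "(norm (x - y))\<^sup>2 \<le> 2 * (norm (p - x))\<^sup>2 + 2 * (norm (p - y))\<^sup>2 - 4 * d"
    if "x \<in> G" "y \<in> G" for x y
  proof -
    \<comment> \<open>The midpoint lies in \<open>G\<close>, which bounds the sum term of the
      parallelogram law from below by \<open>4 * d\<close>.\<close>
    have "(1/2) *\<^sub>R (x + y) \<in> G"
      using add[OF that] scale by (simp add: scaleR_scaleC)
    then have "d \<le> (norm (p - (1/2) *\<^sub>R (x + y)))\<^sup>2"
      by (rule d_le)
    moreover have "p - (1/2) *\<^sub>R (x + y) = (1/2) *\<^sub>R ((p - x) + (p - y))"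
      by (simp add: algebra_simps flip: scaleR_2)
    ultimately have "4 * d \<le> (norm ((p - x) + (p - y)))\<^sup>2"
      by (simp add: power_divide)
    moreover have "(norm (x - y))\<^sup>2 = (norm ((p - y) - (p - x)))\<^sup>2"
      by simp
    ultimately show ?thesis
      using norm_add_square[of "p - y" "p - x"] norm_diff_square[of "p - y" "p - x"]
      by (simp add: add.commute)
  qed
  have "Cauchy m"
  proof (rule metric_CauchyI)
    fix e :: real
    assume "e > 0"
    then have "e\<^sup>2 / 4 > 0"
      by simp
    \<comment> \<open>Both points contribute their excess over \<open>d\<close> with factor 2, so an
      excess below \<open>e\<^sup>2 / 4\<close> for each keeps the squared distance below
      \<open>e\<^sup>2\<close>.\<close>
    then obtain N where N: "inverse (real (Suc N)) < e\<^sup>2 / 4"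
      using reals_Archimedean by blast
    have close: "(norm (p - m k))\<^sup>2 < d + e\<^sup>2 / 4" if "k \<ge> N" for k
    proof -
      have "1 / real (Suc k) \<le> inverse (real (Suc N))"
        using that by (simp add: field_simps)
      then show ?thesis
        using m(2)[of k] N by linarith
    qed
    have "dist (m k) (m l) < e" if "k \<ge> N" "l \<ge> N" for k l
    proof -
      have "(norm (m k - m l))\<^sup>2 < e\<^sup>2"
        using parallelogram[OF m(1) m(1), of k l] close[OF that(1)] close[OF that(2)] by linarith
      then show ?thesis
        using \<open>e > 0\<close> by (simp add: dist_norm power2_less_imp_less)
    qed
    then show "\<exists>N. \<forall>k\<ge>N. \<forall>l\<ge>N. dist (m k) (m l) < e"
      by blast
  qed
  then obtain q where q: "m \<longlonglongrightarrow> q"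
    using Cauchy_convergent convergent_def by blast
  have "q \<in> G"
    using assms(1) m(1) q by (rule closed_sequentially)
  have "(\<lambda>k. (norm (p - m k))\<^sup>2) \<longlonglongrightarrow> (norm (p - q))\<^sup>2"
    by (intro tendsto_intros q)
  moreover have "(\<lambda>k. d + 1 / real (Suc k)) \<longlonglongrightarrow> d + 0"
    by (intro tendsto_intros LIMSEQ_Suc lim_1_over_n)
  ultimately have min: "(norm (p - q))\<^sup>2 \<le> d"
    using m(2) by (simp add: less_imp_le LIMSEQ_le)
  have "cinner u (p - q) = 0" if "u \<in> G" for u
  proof (rule ccontr)
    assume nz: "cinner u (p - q) \<noteq> 0"
    define c where "c = cinner (p - q) u"
    \<comment> \<open>This makes \<open>t *\<^sub>C u\<close> the projection of \<open>p - q\<close>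
      onto the line through \<open>u\<close>; adding it to \<open>q\<close> would lower the squared
      distance by \<open>(cmod c)\<^sup>2 / (norm u)\<^sup>2\<close>.\<close>
    define t where "t = c / complex_of_real ((norm u)\<^sup>2)"
    have "u \<noteq> 0"
      using nz by auto
    have "c \<noteq> 0"
      using nz cinner_commute[of u "p - q"] by (auto simp: c_def)
    have "d \<le> (norm (p - (q + t *\<^sub>C u)))\<^sup>2"
      using add[OF \<open>q \<in> G\<close> scale[OF that]] by (rule d_le)
    also have "p - (q + t *\<^sub>C u) = (p - q) - t *\<^sub>C u"
      by simp
    also have "(norm \<dots>)\<^sup>2 =
        (norm (p - q))\<^sup>2 + (norm (t *\<^sub>C u))\<^sup>2 - 2 * Re (cinner (p - q) (t *\<^sub>C u))"
      by (rule norm_diff_square)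
    finally have "2 * Re (cinner (p - q) (t *\<^sub>C u)) \<le> (norm (t *\<^sub>C u))\<^sup>2"
      using min by simp
    moreover have "cinner (p - q) (t *\<^sub>C u) = complex_of_real ((cmod c)\<^sup>2 / (norm u)\<^sup>2)"
      using complex_norm_square[of c]
      by (simp add: cinner_scaleC_right t_def c_def[symmetric] mult.commute)
    moreover have "(norm (t *\<^sub>C u))\<^sup>2 = (cmod c)\<^sup>2 / (norm u)\<^sup>2"
      using \<open>u \<noteq> 0\<close> by (simp add: norm_scaleC t_def norm_divide norm_mult power2_eq_square)
    ultimately have "2 * ((cmod c)\<^sup>2 / (norm u)\<^sup>2) \<le> (cmod c)\<^sup>2 / (norm u)\<^sup>2"
      by simp
    moreover have "(cmod c)\<^sup>2 / (norm u)\<^sup>2 > 0"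
      using \<open>c \<noteq> 0\<close> \<open>u \<noteq> 0\<close> by simp
    ultimately show False
      by simp
  qed
  then show thesis
    using that \<open>q \<in> G\<close> by blast
qed

text \<open>Graphs live in the product space, and this instance makes orthogonal projection
  available for them. The norm on pairs in the library is Euclidean, hence the one induced by the
  sum of the inner products.\<close>

instantiation prod :: (complex_hilbert_space, complex_hilbert_space) complex_hilbert_space
begin

definition scaleC_prod :: "complex \<Rightarrow> 'a \<times> 'b \<Rightarrow> 'a \<times> 'b"
  where "scaleC_prod a x = (a *\<^sub>C fst x, a *\<^sub>C snd x)"

definition cinner_prod :: "'a \<times> 'b \<Rightarrow> 'a \<times> 'b \<Rightarrow> complex"
  where "cinner_prod x y = cinner (fst x) (fst y) + cinner (snd x) (snd y)"

instance
proof
  fix x y z :: "'a \<times> 'b" and a b :: complex and r :: real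
  show "scaleR r x = complex_of_real r *\<^sub>C x"
    by (simp add: scaleC_prod_def scaleR_prod_def scaleR_scaleC)
  show "a *\<^sub>C (x + y) = a *\<^sub>C x + a *\<^sub>C y" "(a + b) *\<^sub>C x = a *\<^sub>C x + b *\<^sub>C x"
    "a *\<^sub>C b *\<^sub>C x = (a * b) *\<^sub>C x" "1 *\<^sub>C x = x"
    by (simp_all add: scaleC_prod_def scaleC_add_left scaleC_add_right scaleC_scaleC scaleC_one)
  show "cinner x y = cnj (cinner y x)"
    by (simp add: cinner_prod_def flip: cinner_commute)
  show "cinner (x + y) z = cinner x z + cinner y z"
    by (simp add: cinner_prod_def cinner_add_left)
  show "cinner (a *\<^sub>C x) y = a * cinner x y"
    by (simp add: cinner_prod_def scaleC_prod_def cinner_scaleC_left algebra_simps)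
  show "cinner x x = complex_of_real ((norm x)\<^sup>2)"
    by (simp add: cinner_prod_def norm_prod_def cinner_self_norm)
qed

end

section \<open>Linear operators and adjoints\<close>

lemma linear_op_SomeI:
  assumes "T 0 \<noteq> None"
    and "\<And>x y v w. T x = Some v \<Longrightarrow> T y = Some w \<Longrightarrow> T (x + y) = Some (v + w)"
    and "\<And>c x v. T x = Some v \<Longrightarrow> T (c *\<^sub>C x) = Some (c *\<^sub>C v)"
  shows "linear_op T"
  unfolding linear_op_def using assms by (metis domD domIff option.sel)

lemma linear_op_add:
  "linear_op T \<Longrightarrow> T x = Some v \<Longrightarrow> T y = Some w \<Longrightarrow> T (x + y) = Some (v + w)"
  unfolding linear_op_def by (metis domI option.sel)

lemma linear_op_scaleC: "linear_op T \<Longrightarrow> T x = Some v \<Longrightarrow> T (c *\<^sub>C x) = Some (c *\<^sub>C v)"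
  unfolding linear_op_def by (metis domI option.sel)

lemma linear_op_zero:
  assumes "linear_op T"
  shows "T 0 = Some 0"
proof -
  obtain v where "T 0 = Some v"
    using assms by (auto simp: linear_op_def)
  then show ?thesis
    using linear_op_scaleC[OF assms, of 0 v 0] by simp
qed

lemma linear_op_minus: "linear_op T \<Longrightarrow> T x = Some v \<Longrightarrow> T (- x) = Some (- v)"
  using linear_op_scaleC[of T x v "- 1"] by (simp add: scaleC_minus1_left)

lemma linear_op_diff:
  "linear_op T \<Longrightarrow> T x = Some v \<Longrightarrow> T y = Some w \<Longrightarrow> T (x - y) = Some (v - w)"
  using linear_op_add[of T x v "- y" "- w"] by (simp add: linear_op_minus)

lemma linear_op_map_comp:
  assumes "linear_op A" "linear_op B"
  shows "linear_op (A \<circ>\<^sub>m B)"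
proof (rule linear_op_SomeI)
  show "(A \<circ>\<^sub>m B) 0 \<noteq> None"
    using assms by (simp add: linear_op_zero)
next
  fix x y v w
  assume "(A \<circ>\<^sub>m B) x = Some v" "(A \<circ>\<^sub>m B) y = Some w"
  then show "(A \<circ>\<^sub>m B) (x + y) = Some (v + w)"
    unfolding map_comp_Some_iff using assms by (meson linear_op_add)
next
  fix c x v
  assume "(A \<circ>\<^sub>m B) x = Some v"
  then show "(A \<circ>\<^sub>m B) (c *\<^sub>C x) = Some (c *\<^sub>C v)"
    unfolding map_comp_Some_iff using assms by (meson linear_op_scaleC)
qed

text \<open>Density of the domain makes the described \<open>z\<close> unique, so the definite
  description can be eliminated once and for all; later arguments use only this relational
  form.\<close>

lemma adjoint_op_eq_Some_iff:
  fixes T :: "'a::complex_inner operator"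
  assumes "densely_defined T"
  shows "adjoint_op T y = Some z \<longleftrightarrow> (\<forall>x v. T x = Some v \<longrightarrow> cinner v y = cinner x z)"
proof -
  define P where "P z \<longleftrightarrow> (\<forall>x\<in>dom T. cinner (the (T x)) y = cinner x z)" for z
  have adj: "adjoint_op T y = (if \<exists>z. P z then Some (THE z. P z) else None)"
    by (simp only: adjoint_op_def P_def)
  have unique: "z' = z" if "P z" "P z'" for z z'
  proof -
    have "z' - z = 0"
      using that unfolding P_def
      by (intro orthogonal_dense_imp_zero[OF assms[unfolded densely_defined_def]])
        (simp add: cinner_diff_right)
    then show ?thesis
      by simp
  qed
  have the_eq: "(THE z. P z) = z" if "P z" for z
    using that unique[OF that] by (rule the_equality)
  have "adjoint_op T y = Some z \<longleftrightarrow> P z"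
    unfolding adj using the_eq by (metis option.distinct(1) option.inject)
  also have "P z \<longleftrightarrow> (\<forall>x v. T x = Some v \<longrightarrow> cinner v y = cinner x z)"
    unfolding P_def by (metis domD domI option.sel)
  finally show ?thesis .
qed

lemma adjoint_op_SomeI:
  fixes T :: "'a::complex_inner operator"
  assumes "densely_defined T" and "\<And>x v. T x = Some v \<Longrightarrow> cinner v y = cinner x z"
  shows "adjoint_op T y = Some z"
  unfolding adjoint_op_eq_Some_iff[OF assms(1)] by (intro allI impI assms(2))

lemma adjoint_op_SomeD:
  fixes T :: "'a::complex_inner operator"
  assumes "densely_defined T" and "adjoint_op T y = Some z" and "T x = Some v"
  shows "cinner v y = cinner x z"
  by (rule assms(2)[unfolded adjoint_op_eq_Some_iff[OF assms(1)], rule_format, OF assms(3)])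

lemma linear_op_adjoint_op:
  assumes "densely_defined T"
  shows "linear_op (adjoint_op T)"
proof (rule linear_op_SomeI)
  have "adjoint_op T 0 = Some 0"
    by (rule adjoint_op_SomeI[OF assms]) simp
  then show "adjoint_op T 0 \<noteq> None"
    by simp
next
  fix x y v w
  assume "adjoint_op T x = Some v" "adjoint_op T y = Some w"
  note adj = this[THEN adjoint_op_SomeD[OF assms]]
  show "adjoint_op T (x + y) = Some (v + w)"
    by (rule adjoint_op_SomeI[OF assms]) (simp only: cinner_add_right adj)
next
  fix c x v
  assume "adjoint_op T x = Some v"
  note adj = this[THEN adjoint_op_SomeD[OF assms]]
  show "adjoint_op T (c *\<^sub>C x) = Some (c *\<^sub>C v)"
    by (rule adjoint_op_SomeI[OF assms]) (simp only: cinner_scaleC_right adj)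
qed

section \<open>The closure as a linear operator and its pairing with the adjoint\<close>

lemma closure_op_eq_Some_iff:
  assumes "closable_op T"
  shows "closure_op T x = Some y \<longleftrightarrow> (x, y) \<in> closure (Map.graph T)"
  unfolding graph_closure_op[OF assms, symmetric] by (simp add: Map.graph_def)

lemma map_le_closure_op:
  assumes "closable_op T"
  shows "T \<subseteq>\<^sub>m closure_op T"
proof -
  have "T x = Some v \<Longrightarrow> closure_op T x = Some v" for x v
    unfolding closure_op_eq_Some_iff[OF assms]
    by (rule subsetD[OF closure_subset]) (simp add: Map.graph_def)
  then show ?thesis
    by (auto simp: map_le_def)
qed

lemma linear_op_closure_op:
  fixes T :: "'a::complex_inner operator"
  assumes "linear_op T" "closable_op T"
  shows "linear_op (closure_op T)"
proof (rule linear_op_SomeI)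
  show "closure_op T 0 \<noteq> None"
    using linear_op_zero[OF assms(1)] map_le_closure_op[OF assms(2)]
    by (metis domI map_le_def option.distinct(1))
next
  let ?G = "Map.graph T"
  note S = closure_op_eq_Some_iff[OF assms(2)]
  have G_add: "p + q \<in> ?G" if "p \<in> ?G" "q \<in> ?G" for p q
    using that linear_op_add[OF assms(1)] by (auto simp: Map.graph_def)
  \<comment> \<open>Written by components because \<open>'a\<close> is only an inner product space
    here, while scalar multiplication on pairs is instantiated for Hilbert spaces.\<close>
  have G_scaleC: "(c *\<^sub>C fst p, c *\<^sub>C snd p) \<in> ?G" if "p \<in> ?G" for c p
    using that linear_op_scaleC[OF assms(1)] by (auto simp: Map.graph_def)
  {
    fix x y v w
    assume "closure_op T x = Some v" "closure_op T y = Some w"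
    then obtain f g where fg: "\<forall>n. f n \<in> ?G" "f \<longlonglongrightarrow> (x, v)" "\<forall>n. g n \<in> ?G" "g \<longlonglongrightarrow> (y, w)"
      by (auto simp: S closure_sequential)
    have "(\<lambda>n. f n + g n) \<longlonglongrightarrow> (x, v) + (y, w)"
      by (intro tendsto_add fg)
    then show "closure_op T (x + y) = Some (v + w)"
      unfolding S closure_sequential using G_add fg(1,3)
      by (intro exI[of _ "\<lambda>n. f n + g n"]) simp
  }
  fix c x v
  assume "closure_op T x = Some v"
  then obtain f where f: "\<forall>n. f n \<in> ?G" "f \<longlonglongrightarrow> (x, v)"
    by (auto simp: S closure_sequential)
  have "(\<lambda>n. (c *\<^sub>C fst (f n), c *\<^sub>C snd (f n))) \<longlonglongrightarrow> (c *\<^sub>C fst (x, v), c *\<^sub>C snd (x, v))"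
    by (intro tendsto_Pair bounded_linear.tendsto[OF bounded_linear_scaleC]
        tendsto_fst tendsto_snd f(2))
  then show "closure_op T (c *\<^sub>C x) = Some (c *\<^sub>C v)"
    unfolding S closure_sequential using G_scaleC f(1)
    by (intro exI[of _ "\<lambda>n. (c *\<^sub>C fst (f n), c *\<^sub>C snd (f n))"]) simp
qed

text \<open>For fixed \<open>y\<close> and \<open>z\<close> the identity is a closed condition on
  the pair \<open>(x, v)\<close>. It holds on the graph of \<open>T\<close>, hence on its
  closure.\<close>

lemma cinner_closure_op_adjoint_op:
  fixes T :: "'a::complex_inner operator"
  assumes "densely_defined T" "closable_op T"
    and "closure_op T x = Some v" "adjoint_op T y = Some z"
  shows "cinner v y = cinner x z"
proof -
  have "closed {q :: 'a \<times> 'a. cinner (snd q) y = cinner (fst q) z}"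
    by (intro closed_Collect_eq continuous_on_cinner_left continuous_intros)
  then have "closure (Map.graph T) \<subseteq> {q. cinner (snd q) y = cinner (fst q) z}"
    using adjoint_op_SomeD[OF assms(1,4)] by (intro closure_minimal) (auto simp: Map.graph_def)
  then show ?thesis
    using assms(3) by (auto simp: closure_op_eq_Some_iff[OF assms(2)])
qed

text \<open>Project \<open>(v, w)\<close> onto the closed graph, obtaining \<open>(x, y)\<close>.
  Orthogonality of the residual \<open>(v - x, w - y)\<close> to every \<open>(u, T u)\<close> says
  exactly that the adjoint sends \<open>w - y\<close> to \<open>x - v\<close>.\<close>

lemma closure_op_adjoint_op_decomposition:
  fixes T :: "'a::complex_hilbert_space operator"
  assumes "linear_op T" "densely_defined T" "closable_op T"
  obtains x y b c where "closure_op T x = Some y" "adjoint_op T b = Some c"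
    "v = x - c" "w = y + b"
proof -
  let ?G = "closure (Map.graph T)"
  note S = closure_op_eq_Some_iff[OF assms(3)] and lin = linear_op_closure_op[OF assms(1,3)]
  obtain m where m: "m \<in> ?G" "\<And>u. u \<in> ?G \<Longrightarrow> cinner u ((v, w) - m) = 0"
  proof (rule orthogonal_projection_exists[of ?G])
    show "0 \<in> ?G"
      using linear_op_zero[OF lin] by (simp add: S zero_prod_def)
    show "x + y \<in> ?G" if "x \<in> ?G" "y \<in> ?G" for x y
      using linear_op_add[OF lin, of "fst x" "snd x" "fst y" "snd y"] that
      by (simp add: S plus_prod_def)
    show "c *\<^sub>C x \<in> ?G" if "x \<in> ?G" for c x
      using linear_op_scaleC[OF lin, of "fst x" "snd x" c] that by (simp add: S scaleC_prod_def)
  qed auto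
  obtain x y where xy: "m = (x, y)"
    by fastforce
  have "adjoint_op T (w - y) = Some (x - v)"
  proof (rule adjoint_op_SomeI[OF assms(2)])
    fix u t
    assume "T u = Some t"
    then have "(u, t) \<in> ?G"
      using closure_subset by (force simp: Map.graph_def)
    from m(2)[OF this] show "cinner t (w - y) = cinner u (x - v)"
      by (simp add: xy cinner_prod_def cinner_diff_right algebra_simps)
  qed
  moreover have "closure_op T x = Some y"
    using m(1) by (simp add: S xy)
  ultimately show thesis
    using that[of x y "w - y" "x - v"] by simp
qed

section \<open>Restrictions of positive self-adjoint operators\<close>

text \<open>Formulated without the adjoint, whose definition is meaningful only for a dense
  domain.\<close>

definition symmetric_op :: "'a::complex_inner operator \<Rightarrow> bool" where
  "symmetric_op B \<longleftrightarrow> (\<forall>x y v w. B x = Some v \<longrightarrow> B y = Some w \<longrightarrow> cinner v y = cinner x w)"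

definition positive_op :: "'a::complex_inner operator \<Rightarrow> bool" where
  "positive_op B \<longleftrightarrow> (\<forall>x v. B x = Some v \<longrightarrow> 0 \<le> Re (cinner v x))"

text \<open>Both sides equal \<langle>B x, B y\<rangle>. Assuming only that \<open>A\<close> and
  \<open>B\<close> are formally adjoint lets one lemma serve both orders of the closure and the
  adjoint.\<close>

lemma symmetric_op_map_comp:
  assumes adj: "\<And>x v y z. A x = Some v \<Longrightarrow> B y = Some z \<Longrightarrow> cinner v y = cinner x z"
  shows "symmetric_op (A \<circ>\<^sub>m B)"
  unfolding symmetric_op_def
proof (intro allI impI)
  fix x y v w
  assume "(A \<circ>\<^sub>m B) x = Some v" "(A \<circ>\<^sub>m B) y = Some w"
  then obtain p q where *: "B x = Some p" "A p = Some v" "B y = Some q" "A q = Some w"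
    by (auto simp: map_comp_Some_iff)
  have "cinner v y = cnj (cinner q p)"
    using adj[OF *(2,3)] cinner_commute[of p q] by (rule trans)
  also have "\<dots> = cinner x w"
    unfolding adj[OF *(4,1), symmetric] by (rule cinner_commute[symmetric])
  finally show "cinner v y = cinner x w" .
qed

text \<open>Here \<langle>A B x, x\<rangle> is the squared norm of B x.\<close>

lemma positive_op_map_comp:
  assumes adj: "\<And>x v y z. A x = Some v \<Longrightarrow> B y = Some z \<Longrightarrow> cinner v y = cinner x z"
  shows "positive_op (A \<circ>\<^sub>m B)"
  unfolding positive_op_def
proof (intro allI impI)
  fix x v
  assume "(A \<circ>\<^sub>m B) x = Some v"
  then obtain p where "B x = Some p" "A p = Some v"
    by (auto simp: map_comp_Some_iff)
  from adj[OF this(2,1)] show "0 \<le> Re (cinner v x)"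
    by (simp add: cinner_self_norm)
qed

text \<open>Symmetry gives one inclusion. For the other, let the adjoint send \<open>y\<close> to
  \<open>z\<close> and solve x + B x = y + z in the domain of \<open>B\<close>; then
  \<open>y - x\<close> is orthogonal to the range of I + B, which is the whole space, so
  \<open>y = x\<close>.\<close>

lemma adjoint_op_eq_self:
  fixes B :: "'a::complex_inner operator"
  assumes dense: "densely_defined B" and sym: "symmetric_op B"
    and onto: "\<And>h. \<exists>x v. B x = Some v \<and> h = x + v"
  shows "adjoint_op B = B"
proof (rule map_le_antisym)
  have "adjoint_op B y = Some w" if "B y = Some w" for y w
    using sym that by (intro adjoint_op_SomeI[OF dense]) (simp add: symmetric_op_def)
  then show "B \<subseteq>\<^sub>m adjoint_op B"
    by (auto simp: map_le_def)
  have "B y = Some z" if "adjoint_op B y = Some z" for y z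
  proof -
    obtain x v where x: "B x = Some v" "y + z = x + v"
      using onto by blast
    have "cinner h (y - x) = 0" for h
    proof -
      obtain u t where u: "B u = Some t" "h = u + t"
        using onto by blast
      have "cinner t y = cinner u z" "cinner t x = cinner u v"
        using adjoint_op_SomeD[OF dense that u(1)] u(1) x(1) sym by (simp_all add: symmetric_op_def)
      then have "cinner h (y - x) = cinner u ((y + z) - (x + v))"
        by (simp add: u(2) cinner_add_left cinner_add_right cinner_diff_right)
      then show ?thesis
        by (simp add: x(2))
    qed
    then have "y = x"
      using cinner_self_eq_0_iff[of "y - x"] by simp
    then show ?thesis
      using x by simp
  qed
  then show "adjoint_op B \<subseteq>\<^sub>m B"
    by (auto simp: map_le_def)
qed

text \<open>Positivity gives \<parallel>x\<parallel> \<le> \<parallel>x + B x\<parallel>, so I + B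
  is injective and its inverse is bounded by 1. The operator to be inverted is - (I + B), whence the
  minus signs.\<close>

lemma minus_one_in_resolvent_set:
  fixes B :: "'a::complex_inner operator"
  assumes lin: "linear_op B" and pos: "positive_op B"
    and onto: "\<And>h. \<exists>x v. B x = Some v \<and> h = x + v"
  shows "- 1 \<in> resolvent_set B"
proof -
  let ?f = "\<lambda>x. (- 1) *\<^sub>C x - the (B x)"
  have f: "?f x = - (x + v)" if "B x = Some v" for x v
    using that by (simp add: scaleC_minus1_left)
  \<comment> \<open>In the expansion of the squared norm of \<open>x + v\<close> the cross term is
    nonnegative by positivity.\<close>
  have bound: "norm x \<le> norm (x + v)" if "B x = Some v" for x v
  proof -
    have "Re (cinner v x) = Re (cinner x v)"
      by (simp add: cinner_commute[of v x])
    moreover have "0 \<le> Re (cinner v x)"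
      using pos that by (simp add: positive_op_def)
    ultimately have "(norm x)\<^sup>2 \<le> (norm (x + v))\<^sup>2"
      using norm_add_square[of x v] by simp
    then show ?thesis
      by (rule power2_le_imp_le) simp
  qed
  have inj: "inj_on ?f (dom B)"
  proof (rule inj_onI)
    fix x y
    assume "x \<in> dom B" "y \<in> dom B" and eq: "?f x = ?f y"
    then obtain v w where B: "B x = Some v" "B y = Some w"
      by blast
    then have "x + v = y + w"
      using eq f[of x v] f[of y w] by (metis neg_equal_iff_equal)
    then have "(x - y) + (v - w) = 0"
      by (simp add: algebra_simps)
    then show "x = y"
      using bound[OF linear_op_diff[OF lin B]] by simp
  qed
  let ?R = "inv_into (dom B) ?f"
  have inv_eq: "?R (- (x + v)) = x" if "B x = Some v" for x v
    unfolding f[OF that, symmetric] by (rule inv_into_f_f[OF inj]) (simp add: domIff that)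
  have inv: "\<exists>x v. B x = Some v \<and> h = - (x + v) \<and> ?R h = x" for h
  proof -
    obtain x v where x: "B x = Some v" "- h = x + v"
      using onto by blast
    from x(2) have "h = - (x + v)"
      by (metis minus_minus)
    with inv_eq[OF x(1)] x(1) show ?thesis
      by blast
  qed
  have R_scaleC: "?R (c *\<^sub>C h) = c *\<^sub>C ?R h" for c h
  proof -
    obtain x v where x: "B x = Some v" "h = - (x + v)" "?R h = x"
      using inv by blast
    have "c *\<^sub>C h = - (c *\<^sub>C x + c *\<^sub>C v)"
      by (simp add: x(2) scaleC_add_right scaleC_minus_right scaleC_diff_right)
    then show ?thesis
      using inv_eq[OF linear_op_scaleC[OF lin x(1), of c]] x(3) by simp
  qed
  have "bounded_linear ?R"
  proof (rule bounded_linear_intro[where K = 1])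
    fix h k
    obtain x v where x: "B x = Some v" "h = - (x + v)" "?R h = x"
      using inv by blast
    obtain y w where y: "B y = Some w" "k = - (y + w)" "?R k = y"
      using inv by blast
    have "h + k = - ((x + y) + (v + w))"
      by (simp add: x(2) y(2))
    then show "?R (h + k) = ?R h + ?R k"
      using inv_eq[OF linear_op_add[OF lin x(1) y(1)]] x(3) y(3) by simp
    show "?R (r *\<^sub>R h) = r *\<^sub>R ?R h" for r
      using R_scaleC by (simp add: scaleR_scaleC)
    have "norm x \<le> norm (- (x + v))"
      using bound[OF x(1)] by (simp only: norm_minus_cancel)
    then show "norm (?R h) \<le> norm h * 1"
      by (simp only: x(3) x(2)[symmetric] mult_1_right)
  qed
  moreover have "bij_betw ?f (dom B) UNIV"
  proof (rule bij_betw_imageI[OF inj])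
    have "h \<in> ?f ` dom B" for h
    proof -
      obtain x v where x: "B x = Some v" "h = - (x + v)"
        using inv by blast
      show ?thesis
        unfolding x(2) f[OF x(1), symmetric] using x(1) by (intro imageI domI)
    qed
    then show "?f ` dom B = UNIV"
      by blast
  qed
  ultimately show ?thesis
    using R_scaleC by (simp add: resolvent_set_def bounded_clinear_def)
qed

text \<open>A surjective map has no proper injective extension: \<lambda> I - A is onto, so
  injectivity of \<lambda> I - B forces equal domains.\<close>

lemma restriction_eq_symmetric_op:
  fixes A B :: "'a::complex_inner operator"
  assumes lin: "linear_op B" and sym: "symmetric_op B" and le: "A \<subseteq>\<^sub>m B"
    and res: "l \<in> resolvent_set A"
  shows "A = B"
proof -
  have AB: "B x = Some v" if "A x = Some v" for x v
    using le that by (auto simp: map_le_def dom_def)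
  have onto: "\<exists>x v. A x = Some v \<and> h = l *\<^sub>C x - v" for h
  proof -
    have "h \<in> (\<lambda>x. l *\<^sub>C x - the (A x)) ` dom A"
      using res by (simp add: resolvent_set_def bij_betw_def)
    then show ?thesis
      by force
  qed
  have kernel: "z = 0" if z: "B z = Some (l *\<^sub>C z)" for z
  proof (cases "cnj l = l")
    case True
    \<comment> \<open>With \<open>z\<close> in the range of \<lambda> I - A, symmetry turns
      \<langle>z, z\<rangle> into (\<lambda> - cnj \<lambda>) \<langle>u, z\<rangle>, which vanishes
      for real \<lambda>.\<close>
    obtain u t where u: "A u = Some t" "z = l *\<^sub>C u - t"
      using onto by blast
    have "cinner t z = cinner u (l *\<^sub>C z)"
      using sym AB[OF u(1)] z by (simp add: symmetric_op_def)
    then have "cinner z z = 0"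
      using True by (subst (1) u(2)) (simp add: cinner_diff_left cinner_scaleC_left cinner_scaleC_right)
    then show ?thesis
      by simp
  next
    case False
    \<comment> \<open>Both sides are multiples of \<langle>z, z\<rangle>, with the distinct factors
      \<lambda> and cnj \<lambda>.\<close>
    have "cinner (l *\<^sub>C z) z = cinner z (l *\<^sub>C z)"
      using sym z by (simp add: symmetric_op_def)
    then show ?thesis
      using False by (simp add: cinner_scaleC_left cinner_scaleC_right)
  qed
  have "A y = Some w" if y: "B y = Some w" for y w
  proof -
    \<comment> \<open>Choose \<open>x\<close> in the domain of \<open>A\<close> with the same image
      as \<open>y\<close>; the difference \<open>y - x\<close> then lies in the kernel of \<lambda>
      I - B.\<close>
    obtain x v where x: "A x = Some v" "l *\<^sub>C y - w = l *\<^sub>C x - v"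
      using onto by blast
    have "w - v = l *\<^sub>C (y - x)"
      using x(2) by (simp add: scaleC_diff_right algebra_simps)
    then have "B (y - x) = Some (l *\<^sub>C (y - x))"
      using linear_op_diff[OF lin y AB[OF x(1)]] by simp
    then have "y = x"
      using kernel by fastforce
    then show ?thesis
      using x(1) AB y by fastforce
  qed
  then have "B \<subseteq>\<^sub>m A"
    by (auto simp: map_le_def)
  with le show ?thesis
    by (rule map_le_antisym)
qed

text \<open>A point of the resolvent set forces \<open>A = B\<close>, which makes \<open>B\<close>
  densely defined and hence self-adjoint. Conversely, if \<open>A = B\<close> then - 1 is in the
  resolvent set.\<close>

lemma spectrum_restriction_positive_op:
  fixes A B :: "'a::complex_inner operator"
  assumes "linear_op B" "symmetric_op B" "positive_op B"
    and "\<And>h. \<exists>x v. B x = Some v \<and> h = x + v"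
    and "A \<subseteq>\<^sub>m B" "densely_defined A"
  shows "spectrum_op A \<noteq> UNIV \<longleftrightarrow> adjoint_op A = B \<and> B = A"
proof
  assume "spectrum_op A \<noteq> UNIV"
  then obtain l where "l \<in> resolvent_set A"
    by (auto simp: spectrum_op_def)
  then have "A = B"
    using assms restriction_eq_symmetric_op by blast
  with adjoint_op_eq_self[of B] assms show "adjoint_op A = B \<and> B = A"
    by simp
next
  assume "adjoint_op A = B \<and> B = A"
  with minus_one_in_resolvent_set[OF assms(1,3,4)] have "- 1 \<in> resolvent_set A"
    by simp
  then show "spectrum_op A \<noteq> UNIV"
    by (auto simp: spectrum_op_def)
qed

section \<open>Application to the two products of the operator and its adjoint\<close>

theorem theorem7p1:
  fixes T :: "'a::complex_hilbert_space operator"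
  assumes "linear_op T"
    and "densely_defined T"
    and "closable_op T"
  shows "(densely_defined (T \<circ>\<^sub>m adjoint_op T) \<longrightarrow>
            (spectrum_op (T \<circ>\<^sub>m adjoint_op T) \<noteq> UNIV \<longleftrightarrow>
              adjoint_op (T \<circ>\<^sub>m adjoint_op T) = closure_op T \<circ>\<^sub>m adjoint_op T \<and>
              closure_op T \<circ>\<^sub>m adjoint_op T = T \<circ>\<^sub>m adjoint_op T)) \<and>
         (densely_defined (adjoint_op T \<circ>\<^sub>m T) \<longrightarrow>
            (spectrum_op (adjoint_op T \<circ>\<^sub>m T) \<noteq> UNIV \<longleftrightarrow>
              adjoint_op (adjoint_op T \<circ>\<^sub>m T) = adjoint_op T \<circ>\<^sub>m closure_op T \<and>
              adjoint_op T \<circ>\<^sub>m closure_op T = adjoint_op T \<circ>\<^sub>m T))"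
proof -
  let ?S = "closure_op T" and ?T' = "adjoint_op T"
  note lin = linear_op_closure_op[OF assms(1,3)] linear_op_adjoint_op[OF assms(2)]
  note adj = cinner_closure_op_adjoint_op[OF assms(2,3)]
  have adj': "cinner z x = cinner y v" if "?T' y = Some z" "?S x = Some v" for x y z v
    using adj[OF that(2,1)] cinner_commute[of z x] cinner_commute[of y v] by simp
  have le: "?S x = Some v" if "T x = Some v" for x v
    using map_le_closure_op[OF assms(3)] that by (auto simp: map_le_def dom_def)
  have onto1: "\<exists>x v. (?S \<circ>\<^sub>m ?T') x = Some v \<and> h = x + v" for h
  proof -
    \<comment> \<open>The first component 0 gives \<open>x = c\<close>, so the adjoint sends
      \<open>b\<close> into the domain of \<open>?S\<close>, and \<open>y\<close> is the value of
      the product at \<open>b\<close>.\<close>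
    obtain x y b c where "?S x = Some y" "?T' b = Some c" "0 = x - c" "h = y + b"
      by (rule closure_op_adjoint_op_decomposition[OF assms, of 0 h])
    then show ?thesis
      by (intro exI[of _ b] exI[of _ y]) (simp add: add.commute)
  qed
  have onto2: "\<exists>x v. (?T' \<circ>\<^sub>m ?S) x = Some v \<and> h = x + v" for h
  proof -
    \<comment> \<open>Now the second component 0 gives \<open>b = - y\<close>, so by linearity
      \<open>y\<close>, the value of \<open>?S\<close> at \<open>x\<close>, lies in the domain of
      \<open>?T'\<close> and is sent to \<open>- c\<close>.\<close>
    obtain x y b c where d: "?S x = Some y" "?T' b = Some c" "h = x - c" "0 = y + b"
      by (rule closure_op_adjoint_op_decomposition[OF assms, of h 0])
    have "y = - b"
      using d(4) by (simp add: eq_neg_iff_add_eq_0)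
    then have "?T' y = Some (- c)"
      using linear_op_minus[OF lin(2) d(2)] by simp
    with d(1,3) show ?thesis
      by (intro exI[of _ x] exI[of _ "- c"]) simp
  qed
  have le1: "T \<circ>\<^sub>m ?T' \<subseteq>\<^sub>m ?S \<circ>\<^sub>m ?T'" and le2: "?T' \<circ>\<^sub>m T \<subseteq>\<^sub>m ?T' \<circ>\<^sub>m ?S"
    using le by (auto simp: map_le_def map_comp_def split: option.splits)
  show ?thesis
  proof (intro conjI impI)
    show "spectrum_op (T \<circ>\<^sub>m ?T') \<noteq> UNIV \<longleftrightarrow>
        adjoint_op (T \<circ>\<^sub>m ?T') = ?S \<circ>\<^sub>m ?T' \<and> ?S \<circ>\<^sub>m ?T' = T \<circ>\<^sub>m ?T'"
      if "densely_defined (T \<circ>\<^sub>m ?T')"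
      using linear_op_map_comp[OF lin] symmetric_op_map_comp[OF adj] positive_op_map_comp[OF adj]
        onto1 le1 that
      by (rule spectrum_restriction_positive_op)
    show "spectrum_op (?T' \<circ>\<^sub>m T) \<noteq> UNIV \<longleftrightarrow>
        adjoint_op (?T' \<circ>\<^sub>m T) = ?T' \<circ>\<^sub>m ?S \<and> ?T' \<circ>\<^sub>m ?S = ?T' \<circ>\<^sub>m T"
      if "densely_defined (?T' \<circ>\<^sub>m T)"
      using linear_op_map_comp[OF lin(2,1)] symmetric_op_map_comp[OF adj']
        positive_op_map_comp[OF adj'] onto2 le2 that
      by (rule spectrum_restriction_positive_op)
  qed
qed

end
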